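(* Fix integers $m\ge 2$ and $c\ge 1$. There exist constants $C,s_0>0$ depending only on $m,c$ such that for all integers $s\ge s_0$, with $n=ms+c$ and $\ell=s-c$, every shifted family $\mathcal F\subset 2^{[n]}$ with $\nu(\mathcal F)<s$ satisfies \[ y_{\mathcal F}(m)+y_{\mathcal F}(m+1)\ge (2c+2)\binom{n}{m-1}-Cs^{m-2} \] provided one of the following holds: \begin{enumerate} \item $c\ge 2$ and $\mathcal F\not\subseteq\mathcal Q(m,s,\ell)$; \item $c=1$, $\mathcal F\not\subseteq\mathcal Q(m,s,\ell)$ and $\mathcal F\not\subseteq\mathcal W(m,s,\ell)$. \end{enumerate}
   Context: $[b]=\{1,\dots,b\}$. $\nu(\mathcal F)$ is the maximum number of pairwise disjoint sets in $\mathcal F$. For $\mathcal F\subset 2^{[n]}$, $y_{\mathcal F}(i)=\binom{n}{i}-|\mathcal F\cap\binom{[n]}{i}|$. $\mathcal Q(m,s,\ell)=\{P\subset[n]:|P|+|P\cap[ms-c-1]|\ge 2m\}$ and $\mathcal W(m,s,\ell)=\{P\subset[n]:|P\cap[ms-1]|\ge m\}$. Writing a set as $(a_1,\dots,a_k)$ with $a_1<\dots<a_k$, $(a_1,\dots,a_k)$ can be shifted to $(b_1,\dots,b_k)$ if $a_i\ge b_i$ for all $i$; a family is shifted if it is closed under this operation. (The paper writes the error term as $+O(s^{m-2})$ with $m,c$ fixed, $s\to\infty$.) *)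

theory Defs
  imports Complex_Main "HOL-Library.Disjoint_Sets"
begin

text \<open>
  Families are sets of subsets of \<open>{1..n}\<close>. The matching number counts distinct members,
  so the empty set contributes at most one to a disjoint subfamily. \<^const>\<open>Max\<close> is meaningful
  because families on \<open>{1..n}\<close> are finite and the empty subfamily is always a candidate.
\<close>
definition matching_number :: "nat set set \<Rightarrow> nat" where
  "matching_number F = Max (card ` {G. G \<subseteq> F \<and> disjoint G})"

definition missing :: "nat \<Rightarrow> nat set set \<Rightarrow> nat \<Rightarrow> int" where
  "missing n F i = int (n choose i) - int (card (F \<inter> {A. A \<subseteq> {1..n} \<and> card A = i}))"

text \<open>
  On finite sets, \<^const>\<open>list_all2\<close> compares the increasing enumerations position by position
  and forces the two sets to have the same size.
\<close>
definition can_be_shifted :: "nat set \<Rightarrow> nat set \<Rightarrow> bool" where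
  "can_be_shifted A B \<longleftrightarrow>
     list_all2 (\<lambda>a b. a \<ge> b) (sorted_list_of_set A) (sorted_list_of_set B)"

definition shifted :: "nat \<Rightarrow> nat set set \<Rightarrow> bool" where
  "shifted n F \<longleftrightarrow> (\<forall>A\<in>F. \<forall>B\<subseteq>{1..n}. can_be_shifted A B \<longrightarrow> B \<in> F)"

text \<open>
  In the two families below, \<open>c = s - l\<close> and the ground set is \<open>{1..n}\<close> with
  \<open>n = m * s + c\<close>; they are used only for \<open>l \<le> s\<close>. If \<open>m * s < c + 1\<close>, truncated
  subtraction makes the initial segment empty.
\<close>
definition Q_family :: "nat \<Rightarrow> nat \<Rightarrow> nat \<Rightarrow> nat set set" where
  "Q_family m s l =
     {P. P \<subseteq> {1..m * s + (s - l)} \<and> card P + card (P \<inter> {1..m * s - (s - l) - 1}) \<ge> 2 * m}"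

definition W_family :: "nat \<Rightarrow> nat \<Rightarrow> nat \<Rightarrow> nat set set" where
  "W_family m s l = {P. P \<subseteq> {1..m * s + (s - l)} \<and> card (P \<inter> {1..m * s - 1}) \<ge> m}"

end

theory Submission imports Defs
begin

text \<open>
  Let \<open>T\<close> be the last \<open>K\<close> elements of \<open>{1..n}\<close>, for a large constant \<open>K\<close>. Call a singleton or a pair
  \<open>Z\<close> in \<open>T\<close> bad if almost all of the sets \<open>Z \<union> R\<close>, with \<open>R\<close> an \<open>(m - 1)\<close>-subset of the rest, are
  missing from \<open>F\<close>. Each bad \<open>Z\<close> costs \<open>binomial n (m - 1) - O(s^(m - 2))\<close> missing sets, so we may
  assume that there are at most \<open>2 * c + 1\<close> bad singletons and pairs in total. Every element of \<open>T\<close>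
  or pair in \<open>T\<close> that is not bad can be completed greedily to a member of \<open>F\<close>; and by shiftedness
  \<open>F\<close> contains every \<open>m\<close>-set below \<open>T\<close> with at most one element among the top \<open>s div 2\<close> ones, so
  that what is left below \<open>T\<close> can be matched perfectly. Hence \<open>s\<close> disjoint members exist as soon as
  the bad elements can be disposed of. We may discard one element, or use a set of size \<open>m + 1\<close>
  through a pair that is not bad, \<open>c\<close> times in total. This leaves two obstructions, which correspond
  to \<open>Q\<close> (\<open>2 * c + 1\<close> bad elements, no bad pair) and \<open>W\<close> (\<open>c = 1\<close>, two bad elements); in both cases
  a member of \<open>F\<close> outside the exceptional family, taken as the first set of the matching, saves
  exactly the space that was missing.
\<close>

section \<open>Matching number and missing sets\<close>

lemma matching_number_ge:
  assumes "finite F" "G \<subseteq> F" "disjoint G"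
  shows "card G \<le> matching_number F"
  unfolding matching_number_def
proof (rule Max_ge)
  have "finite {G. G \<subseteq> F \<and> disjoint G}"
    by (rule finite_subset[of _ "Pow F"]) (use assms(1) in auto)
  then show "finite (card ` {G. G \<subseteq> F \<and> disjoint G})" by (rule finite_imageI)
  show "card G \<in> card ` {G. G \<subseteq> F \<and> disjoint G}" using assms(2,3) by blast
qed

lemma missing_eq_card:
  "missing n F i = int (card {A. A \<subseteq> {1..n} \<and> card A = i \<and> A \<notin> F})"
proof -
  let ?L = "{A. A \<subseteq> {1..n} \<and> card A = i}"
  have fin: "finite ?L" by (rule finite_subset[of _ "Pow {1..n}"]) auto
  have "card ?L = n choose i" using n_subsets[of "{1..n}" i] by simp
  moreover have "card ?L = card (?L \<inter> F) + card (?L - F)"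
    by (rule card_Int_Diff[OF fin])
  moreover have "card (?L - F) = card {A. A \<subseteq> {1..n} \<and> card A = i \<and> A \<notin> F}"
    by (rule arg_cong[of _ _ card]) blast
  ultimately show ?thesis unfolding missing_def Int_commute[of F] by linarith
qed

section \<open>Shifting of sets\<close>

lemma sorted_list_of_set_insert_greatest:
  fixes x :: nat
  assumes "finite R" "\<And>r. r \<in> R \<Longrightarrow> r < x"
  shows "sorted_list_of_set (insert x R) = sorted_list_of_set R @ [x]"
proof -
  have "sorted_wrt (<) (sorted_list_of_set R @ [x]) \<and> set (sorted_list_of_set R @ [x]) = insert x R"
    using assms by (auto simp: sorted_wrt_append)
  then show ?thesis
    using assms(1) by (metis finite_insert strict_sorted_equal strict_sorted_list_of_set set_sorted_list_of_set)
qed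

lemma can_be_shifted_refl: "can_be_shifted R R"
  unfolding can_be_shifted_def by (simp add: list.rel_refl)

lemma can_be_shifted_above:
  assumes "finite R" "finite S" "card R = card S"
    and "\<And>r t. r \<in> R \<Longrightarrow> t \<in> S \<Longrightarrow> t \<le> r"
  shows "can_be_shifted R S"
  unfolding can_be_shifted_def list_all2_conv_all_nth
proof (intro conjI allI impI)
  fix i assume i: "i < length (sorted_list_of_set R)"
  have "sorted_list_of_set R ! i \<in> R"
    using nth_mem[OF i] assms(1) by simp
  moreover have "i < length (sorted_list_of_set S)" using i assms(3) by simp
  then have "sorted_list_of_set S ! i \<in> S"
    using nth_mem assms(2) by (metis set_sorted_list_of_set)
  ultimately show "sorted_list_of_set R ! i \<ge> sorted_list_of_set S ! i"
    using assms(4) by blast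
qed (use assms(3) in simp)

lemma can_be_shifted_insert:
  assumes "finite R" "finite S" "can_be_shifted R S" "y \<le> x"
    and "\<And>r. r \<in> R \<Longrightarrow> r < x" "\<And>t. t \<in> S \<Longrightarrow> t < y"
  shows "can_be_shifted (insert x R) (insert y S)"
proof -
  have "sorted_list_of_set (insert x R) = sorted_list_of_set R @ [x]"
    "sorted_list_of_set (insert y S) = sorted_list_of_set S @ [y]"
    using assms by (metis sorted_list_of_set_insert_greatest)+
  then show ?thesis
    using assms(3,4) unfolding can_be_shifted_def by (simp only:) (auto intro: list_all2_appendI)
qed

section \<open>Binomial estimates and division into groups\<close>

lemma binomial_le_power: "(n choose k) \<le> n ^ k"
  by (cases "k \<le> n") (auto simp: binomial_le_pow binomial_eq_0)

text \<open>Pascal's rule, applied \<open>d\<close> times: each step lowers the upper index by one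
  and costs a binomial coefficient of at most \<open>n ^ k\<close>.\<close>

lemma binomial_le_binomial_diff:
  "(n choose Suc k) \<le> ((n - d) choose Suc k) + d * n ^ k"
proof (induction d)
  case (Suc d)
  have "((n - d) choose Suc k) \<le> ((n - Suc d) choose Suc k) + n ^ k"
  proof (cases "n - d")
    case (Suc j)
    then have "j \<le> n" "n - Suc d = j" by auto
    then have "(j choose k) \<le> n ^ k"
      using order_trans[OF binomial_le_power power_mono] by blast
    then show ?thesis using Suc \<open>n - Suc d = j\<close> by simp
  qed simp
  then show ?case using Suc by simp
qed simp

text \<open>Groups are removed greedily, each using one element of \<open>I\<close> as long as one
  is left, so that the bound \<open>card (A \<inter> I) \<le> k\<close> survives as \<open>k\<close>
  decreases.\<close>

lemma split_into_groups:
  assumes "finite A" "m * k \<le> card A" "card (A \<inter> I) \<le> k" "m \<ge> 1"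
  obtains G where "disjoint G" "card G = k" "finite G"
    "\<And>S. S \<in> G \<Longrightarrow> S \<subseteq> A \<and> card S = m \<and> card (S \<inter> I) \<le> 1"
proof -
  have "\<exists>G. disjoint G \<and> card G = k \<and> finite G \<and>
    (\<forall>S\<in>G. S \<subseteq> A \<and> card S = m \<and> card (S \<inter> I) \<le> 1)"
    using assms
  proof (induction k arbitrary: A)
    case 0
    show ?case by (intro exI[of _ "{}"]) auto
  next
    case (Suc k)
    have cd: "card A = card (A \<inter> I) + card (A - I)"
      using Suc.prems(1) by (metis card_Int_Diff)
    obtain S where S: "S \<subseteq> A" "card S = m" "card (S \<inter> I) \<le> 1" "card ((A - S) \<inter> I) \<le> k"
    proof (cases "A \<inter> I = {}")
      case True
      have "m \<le> card A" using Suc.prems(2) by simp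
      then obtain S where "S \<subseteq> A" "card S = m" by (rule obtain_subset_with_card_n)
      moreover have "S \<inter> I = {}" "(A - S) \<inter> I = {}" using True calculation by auto
      ultimately show ?thesis using that[of S] by simp
    next
      case False
      then obtain x where x: "x \<in> A" "x \<in> I" by auto
      \<comment> \<open>At most \<open>Suc k\<close> elements of \<open>A\<close> lie in
        \<open>I\<close>, so at least \<open>(m - 1) * Suc k\<close> lie outside, enough to fill up
        the group of \<open>x\<close>.\<close>
      have "m * Suc k \<le> Suc k + card (A - I)" using Suc.prems cd by linarith
      moreover obtain m' where m': "m = Suc m'" using Suc.prems(4) by (cases m) auto
      ultimately have "m' * Suc k \<le> card (A - I)" by simp
      moreover have "m' \<le> m' * Suc k" by simp
      ultimately have "m' \<le> card (A - I)" by linarith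
      then obtain S' where S': "S' \<subseteq> A - I" "card S' = m'" "finite S'"
        by (rule obtain_subset_with_card_n)
      have "card (insert x S') = m" using S' x m' by (subst card_insert_disjoint) auto
      moreover have "insert x S' \<inter> I = {x}" using S' x by auto
      moreover have "(A - insert x S') \<inter> I = (A \<inter> I) - {x}" using S' x by auto
      moreover have "card ((A \<inter> I) - {x}) = card (A \<inter> I) - 1"
        using x Suc.prems(1) by (simp add: card_Diff_singleton)
      moreover have "insert x S' \<subseteq> A" using S' x by auto
      ultimately show ?thesis using that[of "insert x S'"] Suc.prems(3) by simp
    qed
    have "card (A - S) = card A - m"
      using S Suc.prems(1) by (metis card_Diff_subset finite_subset)
    then have "m * k \<le> card (A - S)" using Suc.prems(2) by simp
    then obtain G where G: "disjoint G" "card G = k" "finite G"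
        "\<forall>S'\<in>G. S' \<subseteq> A - S \<and> card S' = m \<and> card (S' \<inter> I) \<le> 1"
      using Suc.IH[of "A - S"] Suc.prems S(4) by auto
    have "S \<noteq> {}" using S(2) Suc.prems(4) by auto
    then have "S \<notin> G" using G(4) by blast
    moreover have "disjoint (insert S G)"
      using G(1,4) by (auto simp: pairwise_insert disjnt_def)
    ultimately show ?case
      using G S by (intro exI[of _ "insert S G"]) auto
  qed
  then obtain G where "disjoint G \<and> card G = k \<and> finite G \<and>
    (\<forall>S\<in>G. S \<subseteq> A \<and> card S = m \<and> card (S \<inter> I) \<le> 1)" ..
  then show ?thesis by (intro that[of G]) auto
qed

section \<open>Completing small sets in the tail\<close>

text \<open>
  Here \<open>{1..h}\<close> is the bulk of the ground set and \<open>Z\<close> lies in the short tail above \<open>h\<close>.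
  If \<open>Z\<close> is extendable, then a greedy choice can complete it to a member of \<open>F\<close> that avoids any
  \<open>M\<close> elements used before; otherwise all but \<open>O(n^(k - 1))\<close> of the sets \<open>Z \<union> R\<close> are missing.
\<close>
definition extendable :: "nat \<Rightarrow> nat \<Rightarrow> nat \<Rightarrow> nat set set \<Rightarrow> nat set \<Rightarrow> bool" where
  "extendable h M k F Z \<longleftrightarrow>
     (\<forall>U. finite U \<longrightarrow> card U \<le> M \<longrightarrow> (\<exists>R. R \<subseteq> {1..h} - U \<and> card R = k \<and> Z \<union> R \<in> F))"

text \<open>A set \<open>U\<close> that blocks \<open>{x}\<close> also blocks \<open>{y}\<close>: as
  \<open>R\<close> lies below \<open>x\<close>, the set \<open>{y} \<union> R\<close> can be shifted
  to \<open>{x} \<union> R\<close>. Hence the bad elements form a final segment.\<close>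

lemma not_extendable_mono:
  assumes "shifted n F" "h < x" "x \<le> y" "y \<le> n" "\<not> extendable h M k F {x}"
  shows "\<not> extendable h M k F {y}"
proof -
  obtain U where U: "finite U" "card U \<le> M"
      "\<And>R. R \<subseteq> {1..h} - U \<Longrightarrow> card R = k \<Longrightarrow> {x} \<union> R \<notin> F"
    using assms(5) unfolding extendable_def by blast
  have "{y} \<union> R \<notin> F" if R: "R \<subseteq> {1..h} - U" "card R = k" for R
  proof
    assume *: "{y} \<union> R \<in> F"
    have "finite R" using R(1) finite_subset by blast
    moreover have "r < x" if "r \<in> R" for r using R(1) that assms(2) by fastforce
    ultimately have "can_be_shifted (insert y R) (insert x R)"
      using assms(3) by (intro can_be_shifted_insert can_be_shifted_refl) force+
    moreover have "insert x R \<subseteq> {1..n}" using R(1) assms(2,3,4) by fastforce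
    ultimately have "insert x R \<in> F" using assms(1) * unfolding shifted_def by auto
    then show False using U(3)[OF R] by simp
  qed
  then show ?thesis using U(1,2) unfolding extendable_def by blast
qed

text \<open>Each \<open>Z\<close> has a blocking set of at most \<open>M\<close> elements, and every
  \<open>k\<close>-set \<open>R\<close> in \<open>{1..h}\<close> that avoids it yields a missing
  set. From \<open>Z \<union> R\<close> both parts can be read off by cutting at \<open>h\<close>,
  so nothing is counted twice.\<close>

lemma not_extendable_missing:
  assumes "finite \<Z>" "h \<le> n"
    and Z: "\<And>Z. Z \<in> \<Z> \<Longrightarrow> Z \<subseteq> {h<..n} \<and> card Z = j \<and> \<not> extendable h M k F Z"
  shows "card \<Z> * ((h - M) choose k) \<le> card {A. A \<subseteq> {1..n} \<and> card A = j + k \<and> A \<notin> F}"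
proof -
  have "\<exists>U. finite U \<and> card U \<le> M \<and> (\<forall>R. R \<subseteq> {1..h} - U \<longrightarrow> card R = k \<longrightarrow> Z \<union> R \<notin> F)"
    if "Z \<in> \<Z>" for Z
    using Z[OF that] unfolding extendable_def by blast
  then obtain U where U: "\<And>Z. Z \<in> \<Z> \<Longrightarrow> finite (U Z) \<and> card (U Z) \<le> M \<and>
      (\<forall>R. R \<subseteq> {1..h} - U Z \<longrightarrow> card R = k \<longrightarrow> Z \<union> R \<notin> F)"
    by metis
  define D where "D = (\<lambda>Z. {R. R \<subseteq> {1..h} - U Z \<and> card R = k})"
  have fD: "finite (D Z)" for Z unfolding D_def by (rule finite_subset[of _ "Pow {1..h}"]) auto
  have "card \<Z> * ((h - M) choose k) = (\<Sum>Z\<in>\<Z>. (h - M) choose k)" by simp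
  also have "\<dots> \<le> (\<Sum>Z\<in>\<Z>. card (D Z))"
  proof (rule sum_mono)
    fix Z assume "Z \<in> \<Z>"
    have UZ: "finite (U Z)" "card (U Z) \<le> M" using U[OF \<open>Z \<in> \<Z>\<close>] by blast+
    then have "h - M \<le> h - card (U Z)" by (intro diff_le_mono2)
    also have "\<dots> \<le> card ({1..h} - U Z)"
      using diff_card_le_card_Diff[OF UZ(1), of "{1..h}"] by simp
    finally show "(h - M) choose k \<le> card (D Z)"
      unfolding D_def by (subst n_subsets) (auto intro: binomial_right_mono)
  qed
  also have "\<dots> = card (Sigma \<Z> D)" using assms(1) fD by simp
  also have "\<dots> \<le> card {A. A \<subseteq> {1..n} \<and> card A = j + k \<and> A \<notin> F}"
  proof (rule card_inj_on_le)
    show "inj_on (\<lambda>(Z, R). Z \<union> R) (Sigma \<Z> D)"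
    proof (rule inj_onI, clarify)
      fix Z R Z' R' assume *: "Z \<in> \<Z>" "R \<in> D Z" "Z' \<in> \<Z>" "R' \<in> D Z'" "Z \<union> R = Z' \<union> R'"
      have sub: "Z \<subseteq> {h<..n}" "Z' \<subseteq> {h<..n}" "R \<subseteq> {1..h}" "R' \<subseteq> {1..h}"
        using * Z unfolding D_def by auto
      have "Z = (Z \<union> R) \<inter> {h<..}" "R = (Z \<union> R) \<inter> {..h}"
        "Z' = (Z' \<union> R') \<inter> {h<..}" "R' = (Z' \<union> R') \<inter> {..h}"
        using sub by fastforce+
      then show "Z = Z' \<and> R = R'" using *(5) by metis
    qed
    show "(\<lambda>(Z, R). Z \<union> R) ` Sigma \<Z> D \<subseteq> {A. A \<subseteq> {1..n} \<and> card A = j + k \<and> A \<notin> F}"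
    proof clarify
      fix Z R assume *: "Z \<in> \<Z>" "R \<in> D Z"
      have sub: "Z \<subseteq> {h<..n}" "R \<subseteq> {1..h}" using * Z unfolding D_def by auto
      then have "finite Z" "finite R" "Z \<inter> R = {}"
        using finite_subset by (blast, blast, fastforce)
      then have "card (Z \<union> R) = j + k"
        using * Z unfolding D_def by (simp add: card_Un_disjoint)
      moreover have "Z \<union> R \<subseteq> {1..n}" using sub assms(2) by fastforce
      moreover have "Z \<union> R \<notin> F" using * U unfolding D_def by blast
      ultimately show "Z \<union> R \<subseteq> {1..n} \<and> card (Z \<union> R) = j + k \<and> Z \<union> R \<notin> F" by blast
    qed
    show "finite {A. A \<subseteq> {1..n} \<and> card A = j + k \<and> A \<notin> F}"
      by (rule finite_subset[of _ "Pow {1..n}"]) auto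
  qed
  finally show ?thesis .
qed

text \<open>The completions are chosen one after another; \<open>U\<close> and all earlier choices
  together never exceed the \<open>M\<close> elements that can be avoided.\<close>

lemma extendable_greedy:
  assumes "finite \<Z>" "\<And>Z. Z \<in> \<Z> \<Longrightarrow> extendable h M k F Z" "finite U" "card U + k * card \<Z> \<le> M"
  shows "\<exists>f. (\<forall>Z\<in>\<Z>. f Z \<subseteq> {1..h} - U \<and> card (f Z) = k \<and> Z \<union> f Z \<in> F) \<and>
             (\<forall>Z\<in>\<Z>. \<forall>Z'\<in>\<Z>. Z \<noteq> Z' \<longrightarrow> f Z \<inter> f Z' = {})"
  using assms
proof (induction \<Z> rule: finite_induct)
  case (insert Y \<Z>)
  then obtain f where f: "\<forall>Z\<in>\<Z>. f Z \<subseteq> {1..h} - U \<and> card (f Z) = k \<and> Z \<union> f Z \<in> F"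
      "\<forall>Z\<in>\<Z>. \<forall>Z'\<in>\<Z>. Z \<noteq> Z' \<longrightarrow> f Z \<inter> f Z' = {}"
    by auto
  let ?V = "U \<union> (\<Union>Z\<in>\<Z>. f Z)"
  have "finite (f Z)" if "Z \<in> \<Z>" for Z
    using f(1) that by (meson finite_Diff finite_atLeastAtMost finite_subset)
  then have fV: "finite ?V" using insert by auto
  have "card (\<Union>Z\<in>\<Z>. f Z) \<le> (\<Sum>Z\<in>\<Z>. card (f Z))" by (rule card_UN_le[OF insert(1)])
  also have "\<dots> = k * card \<Z>" using f(1) by simp
  finally have "card (\<Union>Z\<in>\<Z>. f Z) \<le> k * card \<Z>" .
  moreover have "card ?V \<le> card U + card (\<Union>Z\<in>\<Z>. f Z)" by (rule card_Un_le)
  ultimately have "card ?V \<le> M" using insert.prems(3) insert.hyps by simp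
  moreover have "extendable h M k F Y" using insert.prems(1) by simp
  ultimately obtain R where R: "R \<subseteq> {1..h} - ?V" "card R = k" "Y \<union> R \<in> F"
    using fV unfolding extendable_def by meson
  have "\<forall>Z\<in>\<Z>. R \<inter> f Z = {}" using R(1) by blast
  then show ?case using f R insert(2)
    by (intro exI[of _ "f(Y := R)"]) (auto simp: Int_commute)
qed auto

section \<open>Members below the tail and large matchings\<close>

text \<open>If \<open>S\<close> were missing, so would be every \<open>{y} \<union> R\<close> with
  \<open>y\<close> above \<open>h\<close> and \<open>R\<close> a \<open>k\<close>-set in
  \<open>{g<..h}\<close>: it can be shifted to \<open>S\<close>, whose maximum is at most
  \<open>h\<close> and whose other elements are at most \<open>g\<close>. That is more than
  \<open>few\<close> allows.\<close>

lemma bulk_mem: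
  assumes sh: "shifted n F" and S: "S \<subseteq> {1..h}" "card S = Suc k" "card (S \<inter> {g<..}) \<le> 1"
    and "h \<le> n"
    and few: "card {A. A \<subseteq> {1..n} \<and> card A = Suc k \<and> A \<notin> F} < (n - h) * ((h - g) choose k)"
  shows "S \<in> F"
proof (rule ccontr)
  assume "S \<notin> F"
  have finS: "finite S" and neS: "S \<noteq> {}" using S(2) by (auto simp: card_ge_0_finite)
  define x where "x = Max S"
  define S' where "S' = S - {x}"
  have x: "x \<in> S" "\<And>t. t \<in> S' \<Longrightarrow> t < x"
    using finS neS unfolding x_def S'_def by (auto simp: order.not_eq_order_implies_strict)
  have Sx: "S = insert x S'" "finite S'" "card S' = k"
    using x(1) S(2) finS unfolding S'_def by auto
  have low: "t \<le> g" if "t \<in> S'" for t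
  proof (rule ccontr)
    assume "\<not> t \<le> g"
    then have "{t, x} \<subseteq> S \<inter> {g<..}" using that x Sx(1) by fastforce
    then have "card {t, x} \<le> card (S \<inter> {g<..})" using finS by (intro card_mono finite_Int disjI1)
    then have "card {t, x} \<le> 1" using S(3) by linarith
    then show False using x(2)[OF that] by simp
  qed
  \<comment> \<open>The avoidance bound of \<open>extendable\<close> is taken to be
    \<open>g\<close>, with \<open>{1..g}\<close> as the blocking set, so that the general count of
    missing sets applies.\<close>
  have "\<not> extendable h g k F {y}" if y: "y \<in> {h<..n}" for y
  proof -
    have "{y} \<union> R \<notin> F" if R: "R \<subseteq> {1..h} - {1..g}" "card R = k" for R
    proof
      assume *: "{y} \<union> R \<in> F"
      have finR: "finite R" using R(1) by (rule finite_subset) auto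
      have Rg: "g < r \<and> r \<le> h" if "r \<in> R" for r using R(1) that by force
      have "can_be_shifted R S'"
        using finR Sx R(2) low Rg by (intro can_be_shifted_above) fastforce+
      moreover have "x \<le> y" using x(1) S(1) y by fastforce
      ultimately have "can_be_shifted (insert y R) (insert x S')"
        using finR Sx(2) x(2) Rg y by (intro can_be_shifted_insert) fastforce+
      moreover have "S \<subseteq> {1..n}" using S(1) assms(5) by fastforce
      ultimately have "S \<in> F" using sh * Sx(1) unfolding shifted_def by auto
      then show False using \<open>S \<notin> F\<close> by blast
    qed
    moreover have "finite {1..g}" "card {1..g} \<le> g" by simp_all
    ultimately show ?thesis unfolding extendable_def by blast
  qed
  then have "card ((\<lambda>y. {y}) ` {h<..n}) * ((h - g) choose k)
      \<le> card {A. A \<subseteq> {1..n} \<and> card A = 1 + k \<and> A \<notin> F}"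
    using assms(5) by (intro not_extendable_missing) auto
  moreover have "card ((\<lambda>y. {y}) ` {h<..n}) = n - h" by (simp add: card_image)
  ultimately show False using few by simp
qed

text \<open>The tail outside \<open>X\<close> is cut into the pairs of \<open>\<P>\<close> and
  singletons, each completed by \<open>k\<close> elements from below; the rest of the bulk is
  divided into \<open>(k + 1)\<close>-sets covered by \<open>bulk_mem\<close>. In
  \<open>size\<close>, a member costs \<open>k + 1\<close> elements and a pair one more.\<close>

lemma matching_avoiding:
  assumes sh: "shifted n F" and h: "h \<le> n"
    and few: "card {A. A \<subseteq> {1..n} \<and> card A = Suc k \<and> A \<notin> F} < (n - h) * ((h - g) choose k)"
    and X: "X \<subseteq> {1..n}"
    and P: "disjoint \<P>" "\<And>Z. Z \<in> \<P> \<Longrightarrow> Z \<subseteq> {h<..n} - X \<and> card Z = 2 \<and> extendable h M k F Z"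
    and bad: "\<And>x. x \<in> {h<..n} - X - \<Union>\<P> \<Longrightarrow> extendable h M k F {x}"
    and size: "Suc k * q + card X + card \<P> \<le> n" "card X + k * (n - h) \<le> M" "(h - g) + (n - h) \<le> q"
  obtains G where "G \<subseteq> F" "disjoint G" "card G = q" "\<Union>G \<inter> X = {}" "{} \<notin> G"
proof -
  let ?T = "{h<..n}"
  let ?V = "?T - X - \<Union>\<P>"
  define \<S> where "\<S> = \<P> \<union> (\<lambda>x. {x}) ` ?V"
  have finX: "finite X" using X finite_subset by blast
  have "\<P> \<subseteq> Pow ?T" using P(2) by blast
  then have finP: "finite \<P>" by (rule finite_subset) simp
  have finS: "finite \<S>" unfolding \<S>_def using finP by simp
  have S: "Z \<subseteq> ?T - X \<and> Z \<noteq> {} \<and> extendable h M k F Z" if "Z \<in> \<S>" for Z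
    using that P(2) bad unfolding \<S>_def by fastforce
  have disS: "disjoint \<S>"
    using P(1) unfolding \<S>_def disjoint_def by blast
  have cardS: "card \<S> = card \<P> + card ?V"
  proof -
    have "\<P> \<inter> (\<lambda>x. {x}) ` ?V = {}" using P(2) by fastforce
    then show ?thesis unfolding \<S>_def using finP by (simp add: card_Un_disjoint card_image)
  qed
  have cT: "n - h = card (X \<inter> ?T) + 2 * card \<P> + card ?V"
  proof -
    have "card (\<Union>\<P>) = sum card \<P>"
      using P finite_subset[of _ ?T] by (intro card_Union_disjoint) blast+
    also have "\<dots> = 2 * card \<P>" using P(2) by simp
    finally have "card (\<Union>\<P>) = 2 * card \<P>" .
    moreover have "card (?T - X) = card ((?T - X) \<inter> \<Union>\<P>) + card ?V"
      by (rule card_Int_Diff) simp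
    moreover have "(?T - X) \<inter> \<Union>\<P> = \<Union>\<P>" using P(2) by blast
    moreover have "card ?T = card (?T \<inter> X) + card (?T - X)" by (rule card_Int_Diff) simp
    ultimately show ?thesis by (simp add: Int_commute)
  qed
  have "card \<S> \<le> n - h" using cardS cT by simp
  then have "k * card \<S> \<le> k * (n - h)" by simp
  then have "card X + k * card \<S> \<le> M" using size(2) by linarith
  then have "\<exists>f. (\<forall>Z\<in>\<S>. f Z \<subseteq> {1..h} - X \<and> card (f Z) = k \<and> Z \<union> f Z \<in> F) \<and>
             (\<forall>Z\<in>\<S>. \<forall>Z'\<in>\<S>. Z \<noteq> Z' \<longrightarrow> f Z \<inter> f Z' = {})"
    using S by (intro extendable_greedy[OF finS _ finX]) simp_all
  then obtain f where f: "\<forall>Z\<in>\<S>. f Z \<subseteq> {1..h} - X \<and> card (f Z) = k \<and> Z \<union> f Z \<in> F"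
      "\<forall>Z\<in>\<S>. \<forall>Z'\<in>\<S>. Z \<noteq> Z' \<longrightarrow> f Z \<inter> f Z' = {}"
    by (elim exE conjE)
  define G1 where "G1 = (\<lambda>Z. Z \<union> f Z) ` \<S>"
  have dis1: "(Z \<union> f Z) \<inter> (Z' \<union> f Z') = {}" if "Z \<in> \<S>" "Z' \<in> \<S>" "Z \<noteq> Z'" for Z Z'
  proof -
    have "Z \<inter> Z' = {}" using disS that by (rule disjointD)
    moreover have "f Z \<inter> f Z' = {}" using f(2) that by blast
    moreover have "Y \<subseteq> {h<..} \<and> f Y \<subseteq> {..h}" if "Y \<in> \<S>" for Y
    proof -
      have "Y \<subseteq> ?T" "f Y \<subseteq> {1..h}" using S[OF that] f(1) that by blast+
      then show ?thesis by auto
    qed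
    then have "Z \<subseteq> {h<..}" "Z' \<subseteq> {h<..}" "f Z \<subseteq> {..h}" "f Z' \<subseteq> {..h}"
      using \<open>Z \<in> \<S>\<close> \<open>Z' \<in> \<S>\<close> by blast+
    then have "Z \<inter> f Z' = {}" "f Z \<inter> Z' = {}" by fastforce+
    ultimately show ?thesis by blast
  qed
  have inj1: "inj_on (\<lambda>Z. Z \<union> f Z) \<S>"
    using dis1 S by (intro inj_onI) blast
  have cG1: "card G1 = card \<S>" unfolding G1_def by (rule card_image[OF inj1])
  define A where "A = {1..h} - (X \<union> (\<Union>Z\<in>\<S>. f Z))"
  have "card {1..h} \<le> card A + card ((X \<inter> {1..h}) \<union> (\<Union>Z\<in>\<S>. f Z))"
  proof -
    have "finite (f Z)" if "Z \<in> \<S>" for Z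
      using f(1) that by (meson finite_Diff finite_atLeastAtMost finite_subset)
    then have "card {1..h} \<le> card (A \<union> ((X \<inter> {1..h}) \<union> (\<Union>Z\<in>\<S>. f Z)))"
      using finS finX unfolding A_def by (intro card_mono) auto
    then show ?thesis using card_Un_le le_trans by blast
  qed
  moreover have "card ((X \<inter> {1..h}) \<union> (\<Union>Z\<in>\<S>. f Z)) \<le> card (X \<inter> {1..h}) + card (\<Union>Z\<in>\<S>. f Z)"
    by (rule card_Un_le)
  moreover have "card (\<Union>Z\<in>\<S>. f Z) \<le> (\<Sum>Z\<in>\<S>. card (f Z))" by (rule card_UN_le[OF finS])
  moreover have "(\<Sum>Z\<in>\<S>. card (f Z)) = k * card \<S>" using f(1) by simp
  ultimately have cA: "h \<le> card A + card (X \<inter> {1..h}) + k * card \<S>" by simp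
  have "card X = card (X \<inter> ?T) + card (X - ?T)" by (rule card_Int_Diff[OF finX])
  moreover have "X - ?T = X \<inter> {1..h}" using X h by fastforce
  ultimately have "card X = card (X \<inter> ?T) + card (X \<inter> {1..h})" by simp
  \<comment> \<open>The tail outside \<open>X\<close> has \<open>card \<S> + card \<P>\<close>
    elements, so the terms \<open>card X\<close> and \<open>card \<P>\<close> of
    \<open>size(1)\<close> cancel.\<close>
  then have "Suc k * q \<le> card A + k * card \<S> + card \<S>"
    using size(1) cT cA cardS h by linarith
  then have "Suc k * (q - card \<S>) \<le> card A" by (simp add: diff_mult_distrib2)
  moreover have "finite A" unfolding A_def by simp
  \<comment> \<open>At most \<open>h - g\<close> elements of \<open>A\<close> lie above
    \<open>g\<close>, and at least that many groups are still to be formed because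
    \<open>card \<S> \<le> n - h\<close>.\<close>
  moreover have "card (A \<inter> {g<..}) \<le> q - card \<S>"
  proof -
    have "card (A \<inter> {g<..}) \<le> card {g<..h}" unfolding A_def by (intro card_mono) auto
    then show ?thesis using size(3) \<open>card \<S> \<le> n - h\<close> by simp
  qed
  ultimately obtain G2 where G2: "disjoint G2" "card G2 = q - card \<S>" "finite G2"
    "\<And>S. S \<in> G2 \<Longrightarrow> S \<subseteq> A \<and> card S = Suc k \<and> card (S \<inter> {g<..}) \<le> 1"
    using split_into_groups[of A "Suc k" "q - card \<S>" "{g<..}"] by auto
  have G2h: "S \<subseteq> {1..h}" if "S \<in> G2" for S using G2(4)[OF that] unfolding A_def by blast
  have dis12: "Y \<inter> S = {}" if Y: "Y \<in> G1" and "S \<in> G2" for Y S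
  proof -
    obtain Z where "Z \<in> \<S>" "Y = Z \<union> f Z" using Y unfolding G1_def by blast
    moreover have "Z \<inter> S = {}" using S[OF \<open>Z \<in> \<S>\<close>] G2h[OF \<open>S \<in> G2\<close>] by fastforce
    ultimately show ?thesis using G2(4)[OF \<open>S \<in> G2\<close>] unfolding A_def by blast
  qed
  have ne1: "{} \<notin> G1" using S unfolding G1_def by blast
  show ?thesis
  proof (rule that[of "G1 \<union> G2"])
    have "G1 \<subseteq> F" using f(1) unfolding G1_def by blast
    moreover have "S \<in> F" if "S \<in> G2" for S
      using G2(4)[OF that] G2h[OF that] by (intro bulk_mem[OF sh _ _ _ h few]) auto
    ultimately show "G1 \<union> G2 \<subseteq> F" by blast
    show "disjoint (G1 \<union> G2)"
    proof (rule disjointI)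
      fix Y Y' assume Y: "Y \<in> G1 \<union> G2" "Y' \<in> G1 \<union> G2" "Y \<noteq> Y'"
      have "Y \<inter> Y' = {}" if "Y \<in> G1" "Y' \<in> G1" "Y \<noteq> Y'" for Y Y'
        using that dis1 unfolding G1_def by blast
      moreover have "Y \<inter> Y' = {}" if "Y \<in> G2" "Y' \<in> G2" "Y \<noteq> Y'" for Y Y'
        using G2(1) that by (rule disjointD)
      ultimately show "Y \<inter> Y' = {}" using Y dis12 by blast
    qed
    have "Y \<notin> G2" if "Y \<in> G1" for Y using dis12[OF that, of Y] that ne1 by auto
    then have "G1 \<inter> G2 = {}" by blast
    moreover have "finite G1" unfolding G1_def using finS by simp
    ultimately show "card (G1 \<union> G2) = q"
      using G2 cG1 size(3) \<open>card \<S> \<le> n - h\<close> by (simp add: card_Un_disjoint)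
    have "Y \<inter> X = {}" if "Y \<in> G1" for Y
      using that S f(1) unfolding G1_def by blast
    moreover have "Y \<inter> X = {}" if "Y \<in> G2" for Y
      using G2(4)[OF that] unfolding A_def by blast
    ultimately show "\<Union>(G1 \<union> G2) \<inter> X = {}" by blast
    show "{} \<notin> G1 \<union> G2" using ne1 G2(4) by fastforce
  qed
qed

section \<open>Disjoint non-edges and final segments\<close>

text \<open>With \<open>E\<close> read as the edges of a graph: \<open>N \<ge> 3\<close> vertices
  span at least \<open>N\<close> pairs, and \<open>N = 2 * p + d > card E\<close>, so a non-edge can
  be removed and the induction goes on with the same \<open>d\<close>. The bound
  \<open>2 \<le> p + d\<close> rules out two vertices joined by an edge.\<close>

lemma nonedge_matching:
  assumes "finite B" "card B = 2 * p + d" "finite E" "card E \<le> d + 1" "1 \<le> p" "2 \<le> p + d"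
  shows "\<exists>\<P>. finite \<P> \<and> disjoint \<P> \<and> card \<P> = p \<and> (\<forall>Z\<in>\<P>. Z \<subseteq> B \<and> card Z = 2 \<and> Z \<notin> E)"
  using assms
proof (induction p arbitrary: B)
  case (Suc p)
  show ?case
  proof (cases "p = 1 \<and> d = 0")
    \<comment> \<open>Removing a non-edge might leave two joined vertices. Instead, two perfect
      matchings of the four vertices without a common pair are compared; a single edge spoils at
      most one of them.\<close>
    case True
    then have B4: "card B = 4" using Suc.prems by simp
    then have "2 \<le> card B" by simp
    then obtain S where S: "S \<subseteq> B" "card S = 2" "finite S" by (rule obtain_subset_with_card_n)
    then have "card (B - S) = 2" using B4 by (simp add: card_Diff_subset)
    obtain a b where ab: "S = {a, b}" "a \<noteq> b" using S(2) by (auto simp: card_2_iff)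
    obtain u v where uv: "B - S = {u, v}" "u \<noteq> v"
      using \<open>card (B - S) = 2\<close> by (auto simp: card_2_iff)
    have ne: "u \<noteq> a" "u \<noteq> b" "v \<noteq> a" "v \<noteq> b" using ab uv by blast+
    have mem: "a \<in> B" "b \<in> B" "u \<in> B" "v \<in> B" using ab uv S(1) by blast+
    have E1: "e = e'" if "e \<in> E" "e' \<in> E" for e e'
      using Suc.prems(3,4) True that by (auto simp: card_le_Suc0_iff_eq)
    show ?thesis
    proof (cases "{a, b} \<in> E \<or> {u, v} \<in> E")
      case True
      have "{a, u} \<notin> E" "{b, v} \<notin> E"
        using True E1 ne ab uv by (metis doubleton_eq_iff)+
      then show ?thesis
        using ne ab(2) uv(2) mem \<open>p = 1 \<and> d = 0\<close>
        by (intro exI[of _ "{{a, u}, {b, v}}"]) (auto simp: disjoint_def doubleton_eq_iff)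
    next
      case False
      then show ?thesis
        using ne ab(2) uv(2) mem \<open>p = 1 \<and> d = 0\<close>
        by (intro exI[of _ "{{a, b}, {u, v}}"]) (auto simp: disjoint_def doubleton_eq_iff)
    qed
  next
    case False
    let ?N = "card B"
    have "?N \<ge> 3" using Suc.prems by simp
    then have "?N * 2 \<le> ?N * (?N - 1)" by (intro mult_le_mono2) simp
    then have "?N \<le> ?N choose 2" unfolding choose_two by linarith
    also have "\<dots> = card {Z. Z \<subseteq> B \<and> card Z = 2}" using n_subsets[OF Suc.prems(1)] by simp
    finally have "card E < card {Z. Z \<subseteq> B \<and> card Z = 2}" using Suc.prems by simp
    then have "\<not> {Z. Z \<subseteq> B \<and> card Z = 2} \<subseteq> E"
      using card_mono[OF Suc.prems(3)] by (meson leD)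
    then obtain S where S: "S \<subseteq> B" "card S = 2" "S \<notin> E" by blast
    have finS: "finite S" using S(1) Suc.prems(1) by (rule finite_subset)
    have "\<exists>\<P>. finite \<P> \<and> disjoint \<P> \<and> card \<P> = p \<and> (\<forall>Z\<in>\<P>. Z \<subseteq> B - S \<and> card Z = 2 \<and> Z \<notin> E)"
    proof (cases "p = 0")
      case True
      then show ?thesis by (intro exI[of _ "{}"]) simp
    next
      case p: False
      have "card (B - S) = 2 * p + d"
        using S finS Suc.prems(2) by (simp add: card_Diff_subset)
      moreover have "2 \<le> p + d" "1 \<le> p" using p False by arith+
      ultimately show ?thesis using Suc.prems(1,3,4) by (intro Suc.IH) simp_all
    qed
    then obtain \<P> where P: "finite \<P>" "disjoint \<P>" "card \<P> = p"
        "\<forall>Z\<in>\<P>. Z \<subseteq> B - S \<and> card Z = 2 \<and> Z \<notin> E" by blast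
    have "S \<noteq> {}" using S(2) by auto
    then have "S \<notin> \<P>" using P(4) by blast
    moreover have "disjoint (insert S \<P>)"
      using P(2,4) by (auto simp: pairwise_insert disjnt_def)
    moreover have "\<forall>Z\<in>insert S \<P>. Z \<subseteq> B \<and> card Z = 2 \<and> Z \<notin> E" using P(4) S by blast
    ultimately show ?thesis using P by (intro exI[of _ "insert S \<P>"]) simp
  qed
qed simp

lemma upclosed_eq_greaterThanAtMost:
  fixes B :: "nat set"
  assumes "B \<subseteq> {1..n}" "\<And>x y. x \<in> B \<Longrightarrow> x \<le> y \<Longrightarrow> y \<le> n \<Longrightarrow> y \<in> B"
  shows "B = {n - card B<..n}"
proof (cases "B = {}")
  case False
  have fin: "finite B" using assms(1) by (rule finite_subset) simp
  define x where "x = Min B"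
  have x: "x \<in> B" "\<And>y. y \<in> B \<Longrightarrow> x \<le> y" using fin False unfolding x_def by auto
  have "B = {x..n}"
  proof
    show "B \<subseteq> {x..n}" using x(2) assms(1) by auto
    show "{x..n} \<subseteq> B" using assms(2)[OF x(1)] by auto
  qed
  moreover have "1 \<le> x" "x \<le> n" using x(1) assms(1) by auto
  ultimately have "n - card B = x - 1" by simp
  then show ?thesis using \<open>B = {x..n}\<close> \<open>1 \<le> x\<close> by auto
qed simp

section \<open>Case analysis on the bad elements\<close>

text \<open>The combinatorial core, with all sizes explicit. As \<open>n = m * s + c\<close>, there
  are \<open>c\<close> elements to spare; discarding an element and using a pair cost one each.
  Every element of \<open>B\<close> has to be discarded, covered by a pair outside \<open>E\<close>,
  or absorbed by a given member of \<open>F\<close>.\<close>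

lemma subset_Q_or_W:
  assumes n: "n = m * s + c" "s = l + c" and m: "m = Suc k" and c: "1 \<le> c"
    and FP: "F \<subseteq> Pow {1..n}" and sh: "shifted n F" and nu: "matching_number F < s"
    and h: "h \<le> n" "3 * (m + c) \<le> n - h" "(h - g) + (n - h) < s" "m + c + k * (n - h) \<le> M"
    and missing: "missing n F m + missing n F (m + 1) < int ((n - h) * ((h - g) choose k))"
      "missing n F m + missing n F (m + 1) < int ((2 * c + 2) * ((h - M) choose k))"
  shows "F \<subseteq> Q_family m s l \<or> (c = 1 \<and> F \<subseteq> W_family m s l)"
proof (rule ccontr)
  assume contra: "\<not> ?thesis"
  define y where "y = (\<lambda>i. card {A. A \<subseteq> {1..n} \<and> card A = i \<and> A \<notin> F})"
  have "y m + y (m + 1) < (n - h) * ((h - g) choose k)"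
    and total: "y m + y (m + 1) < (2 * c + 2) * ((h - M) choose k)"
    using missing unfolding missing_eq_card y_def by linarith+
  then have few: "card {A. A \<subseteq> {1..n} \<and> card A = Suc k \<and> A \<notin> F} < (n - h) * ((h - g) choose k)"
    unfolding y_def m by linarith
  let ?T = "{h<..n}"
  define B where "B = {x \<in> ?T. \<not> extendable h M k F {x}}"
  define E where "E = {Z. Z \<subseteq> ?T \<and> card Z = 2 \<and> \<not> extendable h M k F Z}"
  have finF: "finite F" using FP by (rule finite_subset) simp
  have BT: "B \<subseteq> ?T" unfolding B_def by blast
  then have finB: "finite B" by (rule finite_subset) simp
  have "E \<subseteq> Pow ?T" unfolding E_def by blast
  then have finE: "finite E" by (rule finite_subset) simp
  \<comment> \<open>Bad singletons account for missing sets of size \<open>m\<close> and bad pairs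
    for those of size \<open>m + 1\<close>, so the two counts add up.\<close>
  have BE: "card B + card E \<le> 2 * c + 1"
  proof -
    have "card ((\<lambda>x. {x}) ` B) * ((h - M) choose k)
        \<le> card {A. A \<subseteq> {1..n} \<and> card A = 1 + k \<and> A \<notin> F}"
      using finB h(1) by (intro not_extendable_missing) (auto simp: B_def)
    moreover have "card ((\<lambda>x. {x}) ` B) = card B" by (simp add: card_image)
    moreover have "card E * ((h - M) choose k)
        \<le> card {A. A \<subseteq> {1..n} \<and> card A = 2 + k \<and> A \<notin> F}"
      using finE h(1) by (intro not_extendable_missing) (auto simp: E_def)
    ultimately have "(card B + card E) * ((h - M) choose k) < (2 * c + 2) * ((h - M) choose k)"
      using total m unfolding y_def by (simp add: add_mult_distrib)
    then have "card B + card E < 2 * c + 2" by (simp only: mult_less_cancel2)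
    then show ?thesis by simp
  qed
  have Btail: "B = {n - card B<..n}"
  proof (rule upclosed_eq_greaterThanAtMost)
    show "B \<subseteq> {1..n}" using BT by fastforce
    fix x y assume *: "x \<in> B" "x \<le> y" "y \<le> n"
    then have "\<not> extendable h M k F {y}"
      using not_extendable_mono[OF sh, of h x y M k] unfolding B_def by auto
    then show "y \<in> B" using * unfolding B_def by auto
  qed
  have matching: "\<exists>G \<subseteq> F. disjoint G \<and> card G = q \<and> \<Union>G \<inter> X = {} \<and> {} \<notin> G"
    if a: "X \<subseteq> {1..n}" "card X \<le> m + c" "B \<subseteq> X \<union> \<Union>\<P>" "m * q + card X + card \<P> \<le> n" "s - 1 \<le> q"
      "disjoint \<P>" "\<And>Z. Z \<in> \<P> \<Longrightarrow> Z \<subseteq> ?T - X \<and> card Z = 2 \<and> Z \<notin> E" for X \<P> q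
  proof -
    have pairs: "Z \<subseteq> ?T - X \<and> card Z = 2 \<and> extendable h M k F Z" if "Z \<in> \<P>" for Z
      using a(7)[OF that] unfolding E_def by blast
    have singles: "extendable h M k F {x}" if "x \<in> ?T - X - \<Union>\<P>" for x
      using that a(3) unfolding B_def by blast
    have sizes: "Suc k * q + card X + card \<P> \<le> n" "card X + k * (n - h) \<le> M"
      "(h - g) + (n - h) \<le> q"
      using a(2,4,5) h(3,4) unfolding m by linarith+
    show ?thesis
    proof (rule matching_avoiding[OF sh h(1) few a(1,6) pairs singles sizes])
      fix G assume "G \<subseteq> F" "disjoint G" "card G = q" "\<Union>G \<inter> X = {}" "{} \<notin> G"
      then show ?thesis by (intro exI[of _ G] conjI)
    qed
  qed
  have no_matching: False
    if a: "X \<subseteq> {1..n}" "card X \<le> m + c" "B \<subseteq> X \<union> \<Union>\<P>" "m * s + card X + card \<P> \<le> n"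
      "disjoint \<P>" "\<And>Z. Z \<in> \<P> \<Longrightarrow> Z \<subseteq> ?T - X \<and> card Z = 2 \<and> Z \<notin> E" for X \<P>
  proof -
    obtain G where "G \<subseteq> F" "disjoint G" "card G = s"
      using matching[OF a(1-4) _ a(5,6)] by auto
    then show False using matching_number_ge[OF finF, of G] nu by simp
  qed
  have no_matching_with: False
    if a: "P \<in> F" "P \<subseteq> X" "X \<subseteq> {1..n}" "card X \<le> m + c" "B \<subseteq> X \<union> \<Union>\<P>"
      "m * (s - 1) + card X + card \<P> \<le> n"
      "disjoint \<P>" "\<And>Z. Z \<in> \<P> \<Longrightarrow> Z \<subseteq> ?T - X \<and> card Z = 2 \<and> Z \<notin> E" for P X \<P>
  proof -
    obtain G where G: "G \<subseteq> F" "disjoint G" "card G = s - 1" "\<Union>G \<inter> X = {}" "{} \<notin> G"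
      using matching[OF a(3-6) _ a(7,8)] by auto
    have "disjoint (insert P G)"
      using G(2,4) a(2) by (auto simp: pairwise_insert disjnt_def)
    \<comment> \<open>\<open>P\<close> may be empty, and then disjointness alone would not keep it
      out of \<open>G\<close>; this is why \<open>{} \<notin> G\<close> was carried along.\<close>
    moreover have "P \<notin> G"
    proof
      assume "P \<in> G"
      then have "P \<inter> X = {}" using G(4) by blast
      then have "P = {}" using a(2) by blast
      then show False using G(5) \<open>P \<in> G\<close> by blast
    qed
    then have "card (insert P G) = s"
      using G(1,3) finite_subset[OF G(1) finF] nu by simp
    ultimately show False
      using matching_number_ge[OF finF, of "insert P G"] nu G(1) a(1) by simp
  qed
  have s: "s \<ge> 1" using nu by simp
  then have ms: "m * s = m * (s - 1) + m" by (cases s) auto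
  \<comment> \<open>This makes \<open>m * s - c - 1\<close> a genuine, untruncated
    difference.\<close>
  have large: "c + 1 \<le> m * s" using h(2) n(1) m by simp
  have Bn: "B \<subseteq> {1..n}" using BT by fastforce
  have "card B \<le> c \<or> c = 1 \<and> card B = 2 \<or> 2 \<le> c \<and> c < card B \<and> card B \<le> 2 * c
      \<or> card B = 2 * c + 1 \<and> card E = 0"
    using BE c by arith
  then consider "card B \<le> c" | "c = 1" "card B = 2" | "2 \<le> c" "c < card B" "card B \<le> 2 * c"
    | "card B = 2 * c + 1" "E = {}"
    using finE by (metis card_0_eq)
  then show False
  proof cases
    case 1
    then show False using no_matching[of B "{}"] Bn n(1) by simp
  next
    case 2
    then obtain P where P: "P \<in> F" "P \<notin> W_family m s l" using contra by blast
    have PS: "P \<subseteq> {1..n}" using P(1) FP by blast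
    have Beq: "B = {m * s - 1<..n}" using Btail 2 n(1) s m by simp
    \<comment> \<open>Fewer than \<open>m\<close> elements of \<open>P\<close> lie outside
      \<open>B\<close>, so \<open>P \<union> B\<close> fits into the \<open>m + 1\<close> elements
      that \<open>s - 1\<close> sets of size \<open>m\<close> leave over.\<close>
    have "card (P \<inter> {1..m * s - 1}) < m"
      using P(2) PS n 2 unfolding W_family_def by auto
    moreover have "P \<union> B = (P \<inter> {1..m * s - 1}) \<union> B"
      using PS Beq by fastforce
    ultimately have "card (P \<union> B) \<le> m + 1"
      using card_Un_le[of "P \<inter> {1..m * s - 1}" B] 2 by simp
    then show False
      using no_matching_with[OF P(1), of "P \<union> B" "{}"] PS Bn 2 n(1) ms by simp
  next
    case 3
    \<comment> \<open>Chosen so that \<open>2 * p + d = card B\<close> and \<open>p + d = c\<close>: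
      \<open>p\<close> pairs and \<open>d\<close> discarded elements use up \<open>B\<close> at
      total cost \<open>c\<close>. Also \<open>card E \<le> d + 1\<close>, and the side condition
      \<open>2 \<le> p + d\<close> becomes \<open>2 \<le> c\<close>.\<close>
    define p where "p = card B - c"
    define d where "d = 2 * c - card B"
    have "\<exists>\<P>. finite \<P> \<and> disjoint \<P> \<and> card \<P> = p \<and> (\<forall>Z\<in>\<P>. Z \<subseteq> B \<and> card Z = 2 \<and> Z \<notin> E)"
      using 3 BE finB finE unfolding p_def d_def
      by (intro nonedge_matching[where d = d]) (auto simp: d_def)
    then obtain \<P> where P: "finite \<P>" "disjoint \<P>" "card \<P> = p"
        "\<And>Z. Z \<in> \<P> \<Longrightarrow> Z \<subseteq> B \<and> card Z = 2 \<and> Z \<notin> E" by blast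
    have "card (\<Union>\<P>) = sum card \<P>"
      using P finite_subset[OF _ finB] by (intro card_Union_disjoint) blast+
    then have "card (\<Union>\<P>) = 2 * p" using P by simp
    moreover have "\<Union>\<P> \<subseteq> B" using P(4) by blast
    ultimately have "card (B - \<Union>\<P>) = d"
      using finB 3 finite_subset[of "\<Union>\<P>" B] unfolding p_def d_def by (simp add: card_Diff_subset)
    moreover have "Z \<subseteq> ?T - (B - \<Union>\<P>) \<and> card Z = 2 \<and> Z \<notin> E" if "Z \<in> \<P>" for Z
      using P(4)[OF that] BT that by blast
    moreover have "B - \<Union>\<P> \<subseteq> {1..n}" using Bn by blast
    moreover have "d \<le> m + c" "m * s + d + p \<le> n" using 3 n(1) unfolding p_def d_def by linarith+
    ultimately show False
      using no_matching[of "B - \<Union>\<P>" \<P>] P(2,3) by auto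
  next
    case 4
    obtain P where P: "P \<in> F" "P \<notin> Q_family m s l" using contra by blast
    have PS: "P \<subseteq> {1..n}" using P(1) FP by blast
    then have finP: "finite P" by (rule finite_subset) simp
    have Beq: "B = {m * s - c - 1<..n}"
    proof -
      have "n - card B = m * s - c - 1" using 4 n(1) large by simp
      then show ?thesis using Btail by simp
    qed
    have lt: "card P + card (P \<inter> {1..m * s - c - 1}) < 2 * m"
      using P(2) PS n unfolding Q_family_def by auto
    have "card P = card (P \<inter> B) + card (P - B)" by (rule card_Int_Diff[OF finP])
    moreover have "P - B = P \<inter> {1..m * s - c - 1}" using PS Beq by fastforce
    ultimately have cP: "card P = card (P \<inter> B) + card (P \<inter> {1..m * s - c - 1})" by simp
    have cB: "card B = card (B \<inter> P) + card (B - P)" by (rule card_Int_Diff[OF finB])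
    \<comment> \<open>The number of elements to spare, hence of pairs that may be used, beside
      \<open>P\<close> and \<open>s - 1\<close> sets of size \<open>m\<close>.\<close>
    define b where "b = m + c - card P"
    have "card (P \<inter> B) \<le> 2 * c + 1" using 4 card_mono[OF finB, of "P \<inter> B"] by simp
    then have Pmc: "card P \<le> m + c" using lt cP by linarith
    \<comment> \<open>By \<open>lt\<close>,
      \<open>card (P \<inter> B) + 2 * card (P - B) < 2 * m\<close>; this is exactly what makes room
      in \<open>b\<close> pairs for the \<open>2 * c + 1 - card (P \<inter> B)\<close> elements of
      \<open>B - P\<close>.\<close>
    have "card (B - P) \<le> 2 * b"
      using cB cP lt 4 Pmc unfolding b_def by (simp add: Int_commute)
    moreover have "2 * b \<le> card (?T - P)"
      using diff_card_le_card_Diff[OF finP, of ?T] h(2) Pmc unfolding b_def by simp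
    moreover have "B - P \<subseteq> ?T - P" using BT by blast
    \<comment> \<open>\<open>B - P\<close> is padded with other tail elements to size
      \<open>2 * b\<close>; since \<open>E\<close> is empty, any pairing of \<open>Z\<close> will
      do.\<close>
    ultimately obtain Z where Z: "B - P \<subseteq> Z" "Z \<subseteq> ?T - P" "card Z = 2 * b"
      using exists_subset_between[of "B - P" "2 * b" "?T - P"] by auto
    have finZ: "finite Z" using Z(2) by (rule finite_subset) simp
    obtain G where G: "disjoint G" "card G = b" "finite G"
        "\<And>S. S \<in> G \<Longrightarrow> S \<subseteq> Z \<and> card S = 2 \<and> card (S \<inter> {}) \<le> 1"
      using split_into_groups[of Z 2 b "{}"] finZ Z(3) by auto
    have "card (\<Union>G) = sum card G"
      using G finite_subset[OF _ finZ] by (intro card_Union_disjoint) blast+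
    then have "card (\<Union>G) = card Z" using G Z(3) by simp
    moreover have "\<Union>G \<subseteq> Z" using G(4) by blast
    ultimately have "\<Union>G = Z" using finZ by (simp add: card_subset_eq)
    then have "B \<subseteq> P \<union> \<Union>G" using Z(1) by blast
    moreover have "S \<subseteq> ?T - P \<and> card S = 2 \<and> S \<notin> E" if "S \<in> G" for S
      using G(4)[OF that] Z(2) 4 by blast
    moreover have "m * (s - 1) + card P + card G \<le> n"
      using G(2) Pmc n(1) ms unfolding b_def by linarith
    ultimately show False
      using no_matching_with[OF P(1) subset_refl PS Pmc _ _ G(1)] by blast
  qed
qed

section \<open>Choice of constants for large \<open>s\<close>\<close>

text \<open>Both sides have order \<open>s ^ k\<close>: the left is at most
  \<open>(a * s) ^ k\<close>, while \<open>(s div 2) choose k\<close> is at least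
  \<open>(s div 2 / k) ^ k\<close>, and \<open>s \<le> 4 * (s div 2)\<close> once
  \<open>s div 2 \<ge> 1\<close>.\<close>

lemma binomial_le_binomial_half:
  assumes "1 \<le> k" "k \<le> s div 2" "n \<le> a * s"
  shows "(n choose k) \<le> (4 * k * a) ^ k * ((s div 2) choose k)"
proof -
  let ?r = "s div 2"
  have "real s \<le> 4 * real ?r" using assms(1,2) by linarith
  then have "real s \<le> (4 * real k) * (real ?r / real k)" using assms(1) by simp
  moreover have "real n \<le> real a * real s" using assms(3) by (simp flip: of_nat_mult)
  ultimately have "real n \<le> real a * ((4 * real k) * (real ?r / real k))"
    by (meson mult_left_mono of_nat_0_le_iff order_trans)
  also have "\<dots> = (4 * real k * real a) * (real ?r / real k)" by (simp only: ac_simps)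
  finally have "real n ^ k \<le> ((4 * real k * real a) * (real ?r / real k)) ^ k"
    by (rule power_mono) simp
  also have "\<dots> = (4 * real k * real a) ^ k * (real ?r / real k) ^ k"
    by (rule power_mult_distrib)
  also have "\<dots> \<le> (4 * real k * real a) ^ k * real (?r choose k)"
    using binomial_ge_n_over_k_pow_k[OF assms(2), where 'a = real] by (intro mult_left_mono) auto
  finally have "real (n ^ k) \<le> real ((4 * k * a) ^ k * (?r choose k))" by simp
  then have "n ^ k \<le> (4 * k * a) ^ k * (?r choose k)" by (simp only: of_nat_le_iff)
  then show ?thesis using binomial_le_power le_trans by blast
qed

theorem theorem2:
  fixes m c :: nat
  assumes "m \<ge> 2" and "c \<ge> 1"
  shows "\<exists>(C::real) (s0::nat). C > 0 \<and> s0 > 0 \<and>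
    (\<forall>s n l :: nat. \<forall>F :: nat set set.
       s \<ge> s0 \<longrightarrow> n = m * s + c \<longrightarrow> s = l + c \<longrightarrow>
       F \<subseteq> Pow {1..n} \<longrightarrow> shifted n F \<longrightarrow> matching_number F < s \<longrightarrow>
       (c \<ge> 2 \<and> \<not> F \<subseteq> Q_family m s l \<or>
        c = 1 \<and> \<not> F \<subseteq> Q_family m s l \<and> \<not> F \<subseteq> W_family m s l) \<longrightarrow>
       real_of_int (missing n F m + missing n F (m + 1))
         \<ge> (2 * real c + 2) * real (n choose (m - 1)) - C * real s ^ (m - 2))"
proof -
  obtain j where j: "m = Suc (Suc j)" using assms(1) by (metis add_2_eq_Suc le_Suc_ex)
  define k where "k = Suc j"
  \<comment> \<open>\<open>K\<close> is the length of the tail: its first summand serves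
    \<open>few\<close>, its second leaves room for the padding by pairs. \<open>M\<close> allows for
    \<open>X\<close> and \<open>k\<close> elements for each of at most \<open>K\<close> tail sets.
    \<open>C\<close> absorbs the loss from replacing \<open>n\<close> by
    \<open>n - (K + M)\<close>.\<close>
  define K where "K = (2 * c + 2) * (4 * k * (m + c)) ^ k + 3 * (m + c)"
  define M where "M = m + c + k * K"
  define C where "C = (2 * c + 2) * (K + M) * (m + c) ^ j"
  define s0 where "s0 = 2 * K + 2 * k + 4"
  have mk: "m = Suc k" "m - 1 = k" "m - 2 = j" using j k_def by auto
  have main: "real_of_int (missing n F m + missing n F (m + 1))
         \<ge> (2 * real c + 2) * real (n choose (m - 1)) - real C * real s ^ (m - 2)"
    if s: "s \<ge> s0" and n: "n = m * s + c" "s = l + c" and F: "F \<subseteq> Pow {1..n}" "shifted n F"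
      "matching_number F < s"
      and QW: "c \<ge> 2 \<and> \<not> F \<subseteq> Q_family m s l \<or>
        c = 1 \<and> \<not> F \<subseteq> Q_family m s l \<and> \<not> F \<subseteq> W_family m s l" for s n l F
  proof (rule ccontr)
    assume neg: "\<not> ?thesis"
    define y where "y = missing n F m + missing n F (m + 1)"
    let ?N = "n choose k"
    define h where "h = n - K"
    \<comment> \<open>The window from \<open>g\<close> to \<open>h\<close> must be shorter than
      \<open>s - K\<close> to leave enough groups, yet of order \<open>s\<close> to force many
      missing sets.\<close>
    define g where "g = h - s div 2"
    have "real_of_int y < (2 * real c + 2) * real ?N - real C * real s ^ j"
      using neg unfolding mk(2,3) y_def by linarith
    then have "real_of_int (y + int (C * s ^ j)) < real_of_int (int ((2 * c + 2) * ?N))"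
      by (simp add: algebra_simps)
    then have y: "y + int (C * s ^ j) < int ((2 * c + 2) * ?N)" by (simp only: of_int_less_iff)
    have "s \<le> n" using n(1) j by simp
    then have hs: "K \<le> n" "n - h = K" "h \<le> n" "s div 2 \<le> h" "k \<le> s div 2"
      using s unfolding h_def s0_def by linarith+
    then have hg: "h - g = s div 2" unfolding g_def by simp
    have "c \<le> c * s" using s unfolding s0_def by simp
    then have ns: "n \<le> (m + c) * s" using n(1) by (simp add: add_mult_distrib)
    have few: "y < int ((n - h) * ((h - g) choose k))"
    proof -
      have "?N \<le> (4 * k * (m + c)) ^ k * ((s div 2) choose k)"
        using hs(5) ns unfolding k_def by (intro binomial_le_binomial_half) simp_all
      then have "(2 * c + 2) * ?N \<le> (2 * c + 2) * ((4 * k * (m + c)) ^ k * ((s div 2) choose k))"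
        by (rule mult_le_mono2)
      also have "\<dots> = (2 * c + 2) * (4 * k * (m + c)) ^ k * ((s div 2) choose k)"
        by (rule mult.assoc[symmetric])
      also have "\<dots> \<le> K * ((s div 2) choose k)" unfolding K_def by (intro mult_le_mono1) simp
      finally have "y < int (K * ((s div 2) choose k))" using y by linarith
      then show ?thesis using hs(2) hg by simp
    qed
    \<comment> \<open>As \<open>h - M = n - (K + M)\<close>, the loss is \<open>K + M\<close> terms
      of order \<open>s ^ j\<close>, where \<open>j = m - 2\<close>.\<close>
    have "?N \<le> ((h - M) choose k) + (K + M) * n ^ j"
      using binomial_le_binomial_diff[of n j "K + M"] unfolding k_def h_def by simp
    also have "n ^ j \<le> ((m + c) * s) ^ j" using ns by (rule power_mono) simp
    finally have "?N \<le> ((h - M) choose k) + (K + M) * ((m + c) * s) ^ j" by simp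
    then have "(2 * c + 2) * ?N \<le> (2 * c + 2) * (((h - M) choose k) + (K + M) * ((m + c) * s) ^ j)"
      by (rule mult_le_mono2)
    also have "\<dots> = (2 * c + 2) * ((h - M) choose k) + C * s ^ j"
      unfolding C_def power_mult_distrib by (simp add: algebra_simps)
    finally have total: "y < int ((2 * c + 2) * ((h - M) choose k))" using y by linarith
    have "F \<subseteq> Q_family m s l \<or> (c = 1 \<and> F \<subseteq> W_family m s l)"
    proof (rule subset_Q_or_W[OF n mk(1) assms(2) F hs(3)])
      show "3 * (m + c) \<le> n - h" unfolding hs(2) K_def by simp
      show "(h - g) + (n - h) < s" unfolding hs(2) hg using s unfolding s0_def by linarith
      show "m + c + k * (n - h) \<le> M" unfolding hs(2) M_def by simp
    qed (use few total in \<open>simp_all only: y_def\<close>)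
    then show False using QW by auto
  qed
  show ?thesis
  proof (intro exI[of _ "real C"] exI[of _ s0] conjI allI impI)
    have "C > 0" unfolding C_def K_def using assms by simp
    then show "0 < real C" by simp
    show "0 < s0" unfolding s0_def by simp
  qed (rule main; assumption)
qed

end
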